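(* Let $n$ be a positive integer. For every ideal $I$ of $IOF_n^{par}$ there is a convex subset $P^*$ of $\mathcal{P}(\overline{n})$ with $\emptyset\in P^*$, such that $y\in P^*$ implies $z\in P^*$ for all $z\in\mathcal{P}(\overline{n})$ with $z\sim y$, and such that $I=I_{P^*}$.
   Context: Let $\overline{n}=\{1<2<\cdots<n\}$, and let $I_n$ be the monoid of all partial injections $\alpha$ of $\overline{n}$ (injective maps from a subset $dom(\alpha)$ of $\overline{n}$ into $\overline{n}$). Maps are written on the right and composed left to right. The fence order $\prec$ on $\overline{n}$ is: $x\prec y$ iff $|x-y|=1$ and $x$ is odd (so $1\prec 2\succ 3\prec\cdots$). $\alpha\in I_n$ is order-preserving if $x<y$ implies $x\alpha<y\alpha$; fence-preserving if $x\prec y$ implies $x\alpha\prec y\alpha$; parity-preserving if $x$ and $x\alpha$ have the same parity (in each case for all $x,y\in dom(\alpha)$). $IOF_n^{par}$ is the monoid of all $\alpha\in I_n$ that are order-preserving and parity-preserving and such that both $\alpha$ and $\alpha^{-1}$ are fence-preserving. $\mathcal{P}(\overline{n})$ is the power set of $\overline{n}$. For nonempty sets $\{i_1<\cdots<i_k\}$ and $\{j_1<\cdots<j_l\}$ in $\mathcal{P}(\overline{n})$, write $\{i_1<\cdots<i_k\}\sim\{j_1<\cdots<j_l\}$ if $k=l$; $i_r$ and $j_r$ have the same parity for all $r\in\{1,\dots,k\}$; and $i_r-i_{r-1}=1$ iff $j_r-j_{r-1}=1$ for all $r\in\{2,\dots,k\}$. The empty set is $\sim$-related only to itself. $X\subseteq\mathcal{P}(\overline{n})$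 is convex if $A,B\in X$ and $A\subseteq D\subseteq B$ imply $D\in X$. For $X\subseteq\mathcal{P}(\overline{n})$, $I_X=\{\alpha\in IOF_n^{par}: dom(\alpha)\in X\}$. Ideals are two-sided and nonempty. *)

theory Defs
  imports "HOL-Algebra.Group"
begin

text \<open>
  Partial maps of the chain \<open>1 < 2 < \<dots> < n\<close> are elements of \<^typ>\<open>nat \<rightharpoonup> nat\<close>
  whose domain and range lie in \<open>{1..n}\<close>; \<open>the (\<alpha> x)\<close> is the image \<open>x\<alpha>\<close> of a point
  \<open>x \<in> dom \<alpha>\<close>.
\<close>

definition partial_inj :: "nat \<Rightarrow> (nat \<rightharpoonup> nat) set" where
  "partial_inj n = {\<alpha>. dom \<alpha> \<subseteq> {1..n} \<and> ran \<alpha> \<subseteq> {1..n} \<and> inj_on \<alpha> (dom \<alpha>)}"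

definition pinv :: "(nat \<rightharpoonup> nat) \<Rightarrow> (nat \<rightharpoonup> nat)" where
  "pinv \<alpha> = (\<lambda>y. if y \<in> ran \<alpha> then Some (inv_into (dom \<alpha>) \<alpha> (Some y)) else None)"

text \<open>Maps are composed from left to right: in the product \<open>\<alpha>\<beta>\<close> the map \<open>\<alpha>\<close> acts first.\<close>

definition sym_inv_monoid :: "nat \<Rightarrow> (nat \<rightharpoonup> nat) monoid" where
  "sym_inv_monoid n =
     \<lparr>carrier = partial_inj n, mult = (\<lambda>\<alpha> \<beta>. \<beta> \<circ>\<^sub>m \<alpha>), one = Some |` {1..n}\<rparr>"

definition fence_less :: "nat \<Rightarrow> nat \<Rightarrow> bool" where
  "fence_less x y \<longleftrightarrow> \<bar>int x - int y\<bar> = 1 \<and> odd x"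

definition order_preserving :: "(nat \<rightharpoonup> nat) \<Rightarrow> bool" where
  "order_preserving \<alpha> \<longleftrightarrow>
     (\<forall>x\<in>dom \<alpha>. \<forall>y\<in>dom \<alpha>. x < y \<longrightarrow> the (\<alpha> x) < the (\<alpha> y))"

definition fence_preserving :: "(nat \<rightharpoonup> nat) \<Rightarrow> bool" where
  "fence_preserving \<alpha> \<longleftrightarrow>
     (\<forall>x\<in>dom \<alpha>. \<forall>y\<in>dom \<alpha>. fence_less x y \<longrightarrow> fence_less (the (\<alpha> x)) (the (\<alpha> y)))"

definition parity_preserving :: "(nat \<rightharpoonup> nat) \<Rightarrow> bool" where
  "parity_preserving \<alpha> \<longleftrightarrow> (\<forall>x\<in>dom \<alpha>. even x \<longleftrightarrow> even (the (\<alpha> x)))"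

definition IOF_par :: "nat \<Rightarrow> (nat \<rightharpoonup> nat) monoid" where
  "IOF_par n = (sym_inv_monoid n)
     \<lparr>carrier := {\<alpha> \<in> partial_inj n. order_preserving \<alpha> \<and> parity_preserving \<alpha> \<and>
                    fence_preserving \<alpha> \<and> fence_preserving (pinv \<alpha>)}\<rparr>"

definition monoid_ideal :: "'a set \<Rightarrow> ('a, 'b) monoid_scheme \<Rightarrow> bool" where
  "monoid_ideal I M \<longleftrightarrow> I \<noteq> {} \<and> I \<subseteq> carrier M \<and>
     (\<forall>a\<in>I. \<forall>s\<in>carrier M. s \<otimes>\<^bsub>M\<^esub> a \<in> I \<and> a \<otimes>\<^bsub>M\<^esub> s \<in> I)"

text \<open>
  For finite \<open>A\<close> the list \<^term>\<open>sorted_list_of_set A\<close> is the increasing enumeration of \<open>A\<close>,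
  indexed from \<open>0\<close>. Being increasing, its consecutive differences are not affected by
  truncated subtraction.
\<close>

definition set_sim :: "nat set \<Rightarrow> nat set \<Rightarrow> bool" where
  "set_sim A B \<longleftrightarrow>
     A = {} \<and> B = {} \<or>
     A \<noteq> {} \<and> B \<noteq> {} \<and>
     (let i = sorted_list_of_set A; j = sorted_list_of_set B in
        length i = length j \<and>
        (\<forall>r\<in>{0..<length i}. even (i ! r) \<longleftrightarrow> even (j ! r)) \<and>
        (\<forall>r\<in>{1..<length i}. i ! r - i ! (r - 1) = 1 \<longleftrightarrow> j ! r - j ! (r - 1) = 1))"

definition convex_family :: "'a set set \<Rightarrow> bool" where
  "convex_family X \<longleftrightarrow> (\<forall>A\<in>X. \<forall>B\<in>X. \<forall>D. A \<subseteq> D \<and> D \<subseteq> B \<longrightarrow> D \<in> X)"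

definition dom_in :: "nat \<Rightarrow> nat set set \<Rightarrow> (nat \<rightharpoonup> nat) set" where
  "dom_in n X = {\<alpha> \<in> carrier (IOF_par n). dom \<alpha> \<in> X}"

lemma pinv_eq_Some_iff:
  assumes "inj_on \<alpha> (dom \<alpha>)"
  shows "pinv \<alpha> y = Some x \<longleftrightarrow> \<alpha> x = Some y"
proof
  assume "pinv \<alpha> y = Some x"
  then have y: "y \<in> ran \<alpha>" and x: "x = inv_into (dom \<alpha>) \<alpha> (Some y)"
    by (auto simp: pinv_def split: if_splits)
  from y have "Some y \<in> \<alpha> ` dom \<alpha>" by (force simp: ran_def dom_def image_iff)
  then show "\<alpha> x = Some y" unfolding x by (rule f_inv_into_f)
next
  assume a: "\<alpha> x = Some y"
  then have "y \<in> ran \<alpha>" "x \<in> dom \<alpha>" by (auto simp: ran_def)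
  with a assms show "pinv \<alpha> y = Some x"
    using inv_into_f_f[of \<alpha> "dom \<alpha>" x] by (simp add: pinv_def)
qed

lemma partial_inj_iff:
  "\<alpha> \<in> partial_inj n \<longleftrightarrow>
     (\<forall>x y. \<alpha> x = Some y \<longrightarrow> x \<in> {1..n} \<and> y \<in> {1..n}) \<and>
     (\<forall>x x' y. \<alpha> x = Some y \<longrightarrow> \<alpha> x' = Some y \<longrightarrow> x = x')"
proof -
  have "inj_on \<alpha> (dom \<alpha>) \<longleftrightarrow> (\<forall>x x' y. \<alpha> x = Some y \<longrightarrow> \<alpha> x' = Some y \<longrightarrow> x = x')"
    unfolding inj_on_def dom_def by fastforce
  moreover have "dom \<alpha> \<subseteq> {1..n} \<and> ran \<alpha> \<subseteq> {1..n} \<longleftrightarrow>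
      (\<forall>x y. \<alpha> x = Some y \<longrightarrow> x \<in> {1..n} \<and> y \<in> {1..n})"
    unfolding dom_def ran_def by blast
  ultimately show ?thesis unfolding partial_inj_def by blast
qed

lemma IOF_par_carrier_iff:
  "\<alpha> \<in> carrier (IOF_par n) \<longleftrightarrow> \<alpha> \<in> partial_inj n \<and>
     (\<forall>x x'. \<alpha> x = Some x' \<longrightarrow> (even x \<longleftrightarrow> even x')) \<and>
     (\<forall>x y x' y'. \<alpha> x = Some x' \<longrightarrow> \<alpha> y = Some y' \<longrightarrow>
        (x < y \<longrightarrow> x' < y') \<and> (fence_less x y \<longleftrightarrow> fence_less x' y'))"
proof (cases "\<alpha> \<in> partial_inj n")
  case True
  then have inj: "inj_on \<alpha> (dom \<alpha>)" by (simp add: partial_inj_def)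
  have fence: "fence_preserving \<beta> \<longleftrightarrow>
      (\<forall>x y x' y'. \<beta> x = Some x' \<longrightarrow> \<beta> y = Some y' \<longrightarrow> fence_less x y \<longrightarrow> fence_less x' y')" for \<beta>
    unfolding fence_preserving_def dom_def by fastforce
  have inv: "fence_preserving (pinv \<alpha>) \<longleftrightarrow>
      (\<forall>x y x' y'. \<alpha> x = Some x' \<longrightarrow> \<alpha> y = Some y' \<longrightarrow> fence_less x' y' \<longrightarrow> fence_less x y)"
    unfolding fence pinv_eq_Some_iff[OF inj] by blast
  have ord: "order_preserving \<alpha> \<longleftrightarrow>
      (\<forall>x y x' y'. \<alpha> x = Some x' \<longrightarrow> \<alpha> y = Some y' \<longrightarrow> x < y \<longrightarrow> x' < y')"
    unfolding order_preserving_def dom_def by fastforce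
  have par: "parity_preserving \<alpha> \<longleftrightarrow> (\<forall>x x'. \<alpha> x = Some x' \<longrightarrow> (even x \<longleftrightarrow> even x'))"
    unfolding parity_preserving_def dom_def by fastforce
  have "\<alpha> \<in> carrier (IOF_par n) \<longleftrightarrow> \<alpha> \<in> partial_inj n \<and> order_preserving \<alpha> \<and>
      parity_preserving \<alpha> \<and> fence_preserving \<alpha> \<and> fence_preserving (pinv \<alpha>)"
    by (simp add: IOF_par_def)
  then show ?thesis unfolding ord par inv unfolding fence by blast
qed (simp add: IOF_par_def)

lemma monoid_sym_inv_monoid: "monoid (sym_inv_monoid n)"
proof (rule monoidI)
  fix \<alpha> \<beta> \<gamma> :: "nat \<rightharpoonup> nat"
  show "(\<alpha> \<otimes>\<^bsub>sym_inv_monoid n\<^esub> \<beta>) \<otimes>\<^bsub>sym_inv_monoid n\<^esub> \<gamma> =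
        \<alpha> \<otimes>\<^bsub>sym_inv_monoid n\<^esub> (\<beta> \<otimes>\<^bsub>sym_inv_monoid n\<^esub> \<gamma>)"
    by (simp add: sym_inv_monoid_def map_comp_def fun_eq_iff split: option.splits)
next
  fix \<alpha> \<beta>
  assume "\<alpha> \<in> carrier (sym_inv_monoid n)" "\<beta> \<in> carrier (sym_inv_monoid n)"
  then show "\<alpha> \<otimes>\<^bsub>sym_inv_monoid n\<^esub> \<beta> \<in> carrier (sym_inv_monoid n)"
    by (simp add: sym_inv_monoid_def) (simp add: partial_inj_iff map_comp_Some_iff, blast)
next
  show "\<one>\<^bsub>sym_inv_monoid n\<^esub> \<in> carrier (sym_inv_monoid n)"
    by (simp add: sym_inv_monoid_def partial_inj_iff restrict_map_def)
next
  fix \<alpha>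
  assume "\<alpha> \<in> carrier (sym_inv_monoid n)"
  then have "dom \<alpha> \<subseteq> {1..n}" "ran \<alpha> \<subseteq> {1..n}"
    by (simp_all add: sym_inv_monoid_def partial_inj_def)
  then have d: "\<alpha> x = None" if "x \<notin> {1..n}" for x using that by blast
  have r: "y \<in> {1..n}" if "\<alpha> x = Some y" for x y
    using that \<open>ran \<alpha> \<subseteq> {1..n}\<close> by (auto simp: ran_def)
  show "\<one>\<^bsub>sym_inv_monoid n\<^esub> \<otimes>\<^bsub>sym_inv_monoid n\<^esub> \<alpha> = \<alpha>"
    by (rule ext) (use d in \<open>simp add: sym_inv_monoid_def map_comp_def restrict_map_def\<close>)
  show "\<alpha> \<otimes>\<^bsub>sym_inv_monoid n\<^esub> \<one>\<^bsub>sym_inv_monoid n\<^esub> = \<alpha>"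
    by (rule ext) (use r in \<open>auto simp: sym_inv_monoid_def map_comp_def restrict_map_def split: option.split\<close>)
qed

lemma monoid_IOF_par: "monoid (IOF_par n)"
proof -
  interpret S: monoid "sym_inv_monoid n" by (rule monoid_sym_inv_monoid)
  have sub: "carrier (IOF_par n) \<subseteq> carrier (sym_inv_monoid n)"
    by (auto simp: IOF_par_def sym_inv_monoid_def)
  have ops: "mult (IOF_par n) = mult (sym_inv_monoid n)" "one (IOF_par n) = one (sym_inv_monoid n)"
    by (simp_all add: IOF_par_def)
  have one: "\<one>\<^bsub>IOF_par n\<^esub> \<in> carrier (IOF_par n)"
    unfolding ops IOF_par_carrier_iff
    by (auto simp: sym_inv_monoid_def partial_inj_iff restrict_map_def split: if_splits)
  have mult: "\<alpha> \<otimes>\<^bsub>IOF_par n\<^esub> \<beta> \<in> carrier (IOF_par n)"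
    if a: "\<alpha> \<in> carrier (IOF_par n)" and b: "\<beta> \<in> carrier (IOF_par n)" for \<alpha> \<beta>
  proof -
    have "\<alpha> \<otimes>\<^bsub>sym_inv_monoid n\<^esub> \<beta> \<in> partial_inj n"
      using a b sub S.m_closed[of \<alpha> \<beta>] by (auto simp: sym_inv_monoid_def)
    moreover have "(\<alpha> \<otimes>\<^bsub>sym_inv_monoid n\<^esub> \<beta>) x = Some z \<longleftrightarrow>
        (\<exists>y. \<alpha> x = Some y \<and> \<beta> y = Some z)" for x z
      by (auto simp: sym_inv_monoid_def map_comp_Some_iff)
    ultimately show ?thesis
      using a b unfolding ops IOF_par_carrier_iff by (simp only:) blast
  qed
  show ?thesis
    by (rule monoidI) (use one mult sub in \<open>auto simp: ops intro!: S.m_assoc\<close>)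
qed

end

theory Submission
  imports Defs
begin

text \<open>
  The required family consists of the domains of the members of \<open>I\<close>. Multiplying on the left by
  partial identities shows that it is closed under subsets, and multiplying on the left by the
  increasing bijection between two related sets shows that it is closed under \<open>\<sim>\<close>. A map \<open>\<alpha>\<close>
  with the same domain as some \<open>\<beta> \<in> I\<close> lies in \<open>I\<close> because \<open>\<alpha> = \<beta> \<beta>\<inverse> \<alpha>\<close>.
\<close>

lemma mult_IOF_par: "\<alpha> \<otimes>\<^bsub>IOF_par n\<^esub> \<beta> = \<beta> \<circ>\<^sub>m \<alpha>"
  by (simp add: IOF_par_def sym_inv_monoid_def)

lemma IOF_par_inj_on:
  assumes "\<alpha> \<in> carrier (IOF_par n)"
  shows "inj_on \<alpha> (dom \<alpha>)"
  using assms by (simp add: IOF_par_carrier_iff partial_inj_def)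

lemma IOF_par_dom_subset:
  assumes "\<alpha> \<in> carrier (IOF_par n)"
  shows "dom \<alpha> \<subseteq> {1..n}"
  using assms by (simp add: IOF_par_carrier_iff partial_inj_def)

lemma restrict_Some_in_IOF_par:
  assumes "A \<subseteq> {1..n}"
  shows "Some |` A \<in> carrier (IOF_par n)"
  using assms by (auto simp: IOF_par_carrier_iff partial_inj_iff restrict_map_def split: if_splits)

text \<open>The parity and fence conditions in \<open>IOF_par_carrier_iff\<close> are equivalences,
  so they survive inversion. The order condition is an implication only; it reverses because
  \<open><\<close> is total on the naturals.\<close>

lemma pinv_in_IOF_par:
  assumes \<alpha>: "\<alpha> \<in> carrier (IOF_par n)"
  shows "pinv \<alpha> \<in> carrier (IOF_par n)"
proof -
  have inv: "pinv \<alpha> y = Some x \<longleftrightarrow> \<alpha> x = Some y" for x y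
    using IOF_par_inj_on[OF \<alpha>] by (rule pinv_eq_Some_iff)
  have "x < y" if "\<alpha> x = Some x'" "\<alpha> y = Some y'" "x' < y'" for x y x' y'
  proof (rule ccontr)
    assume "\<not> x < y"
    then consider "x = y" | "y < x" by linarith
    then show False
    proof cases
      case 1
      with that show False by simp
    next
      case 2
      with \<alpha> that have "y' < x'" unfolding IOF_par_carrier_iff by blast
      with that show False by simp
    qed
  qed
  moreover have "x \<in> {1..n}" "y \<in> {1..n}" "even x \<longleftrightarrow> even y" if "\<alpha> x = Some y" for x y
    using \<alpha> that unfolding IOF_par_carrier_iff partial_inj_iff by blast+
  moreover have "fence_less x y \<longleftrightarrow> fence_less x' y'"
    if "\<alpha> x = Some x'" "\<alpha> y = Some y'" for x y x' y'
    using \<alpha> that unfolding IOF_par_carrier_iff by blast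
  ultimately show ?thesis
    unfolding IOF_par_carrier_iff partial_inj_iff inv by (intro conjI allI impI) simp_all
qed

text \<open>No natural number lies strictly between two successive ones, so in a strictly increasing
  list they occupy adjacent positions. This links the fence, which compares arbitrary points, with
  the gap condition of \<open>set_sim\<close>, which compares neighbouring entries only.\<close>

lemma sorted_wrt_less_nth_Suc_iff:
  assumes "sorted_wrt (<) l" "r < length l" "s < length l"
  shows "l ! s = Suc (l ! r) \<longleftrightarrow> s = Suc r \<and> l ! s - l ! (s - 1) = 1"
proof
  assume eq: "l ! s = Suc (l ! r)"
  have mono: "l ! p < l ! q" if "p < q" "q < length l" for p q
    using assms(1) that by (simp add: sorted_wrt_nth_less)
  have "r \<noteq> s" using eq by (metis n_not_Suc_n)
  moreover have "\<not> s < r" using mono[of s r] eq assms(2) by linarith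
  ultimately have "r < s" by simp
  moreover have "\<not> Suc r < s"
    using mono[of r "Suc r"] mono[of "Suc r" s] eq assms(3) by linarith
  ultimately have "s = Suc r" by simp
  with eq show "s = Suc r \<and> l ! s - l ! (s - 1) = 1" by simp
qed auto

text \<open>The map sends the r-th smallest element of \<open>A\<close> to the r-th smallest of
  \<open>B\<close>. Each clause of \<open>set_sim\<close> supplies one requirement: equal lengths a
  bijection, parities parity preservation, and gaps, together with parities, the fence condition in
  both directions.\<close>

lemma set_sim_bijection:
  assumes sim: "set_sim A B" and A: "A \<subseteq> {1..n}" and B: "B \<subseteq> {1..n}"
  obtains \<beta> where "\<beta> \<in> carrier (IOF_par n)" "dom \<beta> = A" "ran \<beta> = B"
proof
  define i where "i = sorted_list_of_set A"
  define j where "j = sorted_list_of_set B"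
  define \<beta> where "\<beta> = map_of (zip i j)"
  have fin: "finite A" "finite B"
    using A B by (auto intro: finite_subset)
  have i: "sorted_wrt (<) i" "distinct i" "set i = A"
    and j: "sorted_wrt (<) j" "distinct j" "set j = B"
    using fin by (simp_all add: i_def j_def)
  \<comment> \<open>If both sets are empty, both lists are empty and the indexed conditions hold
    vacuously.\<close>
  have len: "length i = length j"
    and par: "\<And>r. r < length i \<Longrightarrow> even (i ! r) \<longleftrightarrow> even (j ! r)"
    and gap: "\<And>r. 1 \<le> r \<Longrightarrow> r < length i \<Longrightarrow>
      i ! r - i ! (r - 1) = 1 \<longleftrightarrow> j ! r - j ! (r - 1) = 1"
    using sim unfolding set_sim_def i_def j_def by (auto simp: Let_def)
  \<comment> \<open>The keys in \<open>i\<close> are distinct, so lookup in the zipped list is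
    membership in it.\<close>
  have \<beta>_iff: "\<beta> x = Some y \<longleftrightarrow> (\<exists>r<length i. x = i ! r \<and> y = j ! r)" for x y
    unfolding \<beta>_def using i len by (auto simp: set_zip)
  show "dom \<beta> = A"
    unfolding \<beta>_def using len i by (simp add: dom_map_of_zip)
  show "ran \<beta> = B"
    unfolding \<beta>_def using len i j by (simp add: ran_map_of_zip)
  have inj: "\<beta> \<in> partial_inj n"
    unfolding partial_inj_iff \<beta>_iff
  proof (intro conjI allI impI; elim exE conjE)
    fix x y r
    assume r: "r < length i" "x = i ! r" "y = j ! r"
    then have "x \<in> A" "y \<in> B" using i(3) j(3) len by auto
    then show "x \<in> {1..n}" "y \<in> {1..n}" using A B by auto
  next
    fix x x' y r s
    assume "r < length i" "x = i ! r" "y = j ! r" "s < length i" "x' = i ! s" "y = j ! s"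
    then show "x = x'" using nth_eq_iff_index_eq[OF j(2)] len by auto
  qed
  have Suc_iff: "i ! s = Suc (i ! r) \<longleftrightarrow> j ! s = Suc (j ! r)"
    if "r < length i" "s < length i" for r s
    using sorted_wrt_less_nth_Suc_iff[OF i(1)] sorted_wrt_less_nth_Suc_iff[OF j(1)] gap[of s] len that
    by auto
  have fence_iff: "fence_less x y \<longleftrightarrow> (y = Suc x \<or> x = Suc y) \<and> odd x" for x y
    unfolding fence_less_def by auto
  have less: "i ! r < i ! s \<longrightarrow> j ! r < j ! s" if "r < length i" "s < length i" for r s
    using sorted_wrt_nth_less[OF i(1), of s r] sorted_wrt_nth_less[OF j(1), of r s] len that
    by (cases r s rule: linorder_cases) auto
  show "\<beta> \<in> carrier (IOF_par n)"
    unfolding IOF_par_carrier_iff \<beta>_iff fence_iff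
  proof (intro conjI allI impI inj; elim exE conjE)
    fix x x' r
    assume "r < length i" "x = i ! r" "x' = j ! r"
    then show "even x \<longleftrightarrow> even x'" using par by simp
  next
    fix x y x' y' r s
    assume "r < length i" "x = i ! r" "x' = j ! r" "s < length i" "y = i ! s" "y' = j ! s"
    then show "(y = Suc x \<or> x = Suc y) \<and> odd x \<longleftrightarrow> (y' = Suc x' \<or> x' = Suc y') \<and> odd x'"
      using par Suc_iff by simp
  next
    fix x y x' y' r s
    assume "r < length i" "x = i ! r" "x' = j ! r" "s < length i" "y = i ! s" "y' = j ! s" "x < y"
    then show "x' < y'" using less by simp
  qed
qed

text \<open>The left factor of a product acts first, so multiplying on the left by the identity on
  \<open>D\<close> cuts the domain down to \<open>D\<close>. This downward closure yields both
  convexity and membership of the empty set.\<close>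

lemma monoid_ideal_dom_subset:
  assumes I: "monoid_ideal I (IOF_par n)" and \<alpha>: "\<alpha> \<in> I" and D: "D \<subseteq> dom \<alpha>"
  shows "D \<in> dom ` I"
proof
  have "D \<subseteq> {1..n}"
    using assms IOF_par_dom_subset unfolding monoid_ideal_def by blast
  with I \<alpha> show "\<alpha> \<circ>\<^sub>m (Some |` D) \<in> I"
    using restrict_Some_in_IOF_par unfolding monoid_ideal_def mult_IOF_par by blast
  show "D = dom (\<alpha> \<circ>\<^sub>m (Some |` D))"
    using D by (auto simp: map_comp_def restrict_map_def split: option.splits if_splits)
qed

lemma monoid_ideal_dom_sim:
  assumes I: "monoid_ideal I (IOF_par n)" and \<alpha>: "\<alpha> \<in> I"
    and A: "A \<subseteq> {1..n}" and sim: "set_sim A (dom \<alpha>)"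
  shows "A \<in> dom ` I"
proof -
  have "dom \<alpha> \<subseteq> {1..n}"
    using I \<alpha> IOF_par_dom_subset unfolding monoid_ideal_def by blast
  with sim A obtain \<beta> where \<beta>: "\<beta> \<in> carrier (IOF_par n)" "dom \<beta> = A" "ran \<beta> = dom \<alpha>"
    by (rule set_sim_bijection)
  have "\<alpha> \<circ>\<^sub>m \<beta> \<in> I"
    using I \<alpha> \<beta>(1) unfolding monoid_ideal_def mult_IOF_par by blast
  \<comment> \<open>Since \<open>ran \<beta> = dom \<alpha>\<close>, no point of \<open>A\<close> is
    lost in the composition.\<close>
  moreover have "\<exists>z. (\<alpha> \<circ>\<^sub>m \<beta>) x = Some z" if "\<beta> x = Some y" for x y
    using that \<beta>(3) by (auto simp: map_comp_Some_iff ran_def)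
  then have "dom (\<alpha> \<circ>\<^sub>m \<beta>) = dom \<beta>"
    by (auto simp: map_comp_Some_iff)
  ultimately show ?thesis using \<beta>(2) by blast
qed

lemma monoid_ideal_dom_eq:
  assumes I: "monoid_ideal I (IOF_par n)" and \<beta>: "\<beta> \<in> I"
    and \<alpha>: "\<alpha> \<in> carrier (IOF_par n)" and dom: "dom \<alpha> = dom \<beta>"
  shows "\<alpha> \<in> I"
proof -
  have carrier: "\<beta> \<in> carrier (IOF_par n)"
    using I \<beta> by (auto simp: monoid_ideal_def)
  have inv: "pinv \<beta> y = Some x \<longleftrightarrow> \<beta> x = Some y" for x y
    using IOF_par_inj_on[OF carrier] by (rule pinv_eq_Some_iff)
  \<comment> \<open>\<open>\<beta>\<close> followed by its inverse is the identity on
    \<open>dom \<beta>\<close>, which is also \<open>dom \<alpha>\<close>.\<close>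
  have "(\<alpha> \<circ>\<^sub>m (pinv \<beta> \<circ>\<^sub>m \<beta>)) x = \<alpha> x" for x
  proof (cases "\<beta> x")
    case None
    with dom have "\<alpha> x = None" by (metis domIff)
    with None show ?thesis by (simp add: map_comp_def)
  next
    case (Some y)
    then have "pinv \<beta> y = Some x" using inv by simp
    with Some show ?thesis by (simp add: map_comp_def)
  qed
  then have "\<alpha> \<circ>\<^sub>m (pinv \<beta> \<circ>\<^sub>m \<beta>) = \<alpha>" by blast
  \<comment> \<open>Starting from \<open>\<beta>\<close>, the ideal absorbs two right factors: first
    \<open>pinv \<beta>\<close>, then \<open>\<alpha>\<close>.\<close>
  moreover have "\<alpha> \<circ>\<^sub>m (pinv \<beta> \<circ>\<^sub>m \<beta>) \<in> I"
    using I \<beta> \<alpha> pinv_in_IOF_par[OF carrier] unfolding monoid_ideal_def mult_IOF_par by blast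
  ultimately show ?thesis by simp
qed

theorem proposition3:
  fixes n :: nat and I :: "(nat \<rightharpoonup> nat) set"
  assumes "n > 0"
    and "monoid_ideal I (IOF_par n)"
  shows "\<exists>P \<subseteq> Pow {1..n}. convex_family P \<and> {} \<in> P \<and>
           (\<forall>y\<in>P. \<forall>z\<in>Pow {1..n}. set_sim z y \<longrightarrow> z \<in> P) \<and>
           I = dom_in n P"
proof (intro exI conjI)
  note I = assms(2)
  have carrier: "I \<subseteq> carrier (IOF_par n)" and "I \<noteq> {}"
    using I by (simp_all add: monoid_ideal_def)
  \<comment> \<open>This goal fixes the witness for \<open>P\<close>: the set of domains of members
    of \<open>I\<close>.\<close>
  show "dom ` I \<subseteq> Pow {1..n}"
    using carrier IOF_par_dom_subset by blast
  show "convex_family (dom ` I)"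
    unfolding convex_family_def using monoid_ideal_dom_subset[OF I] by blast
  show "{} \<in> dom ` I"
    using \<open>I \<noteq> {}\<close> monoid_ideal_dom_subset[OF I] by blast
  show "\<forall>y\<in>dom ` I. \<forall>z\<in>Pow {1..n}. set_sim z y \<longrightarrow> z \<in> dom ` I"
    using monoid_ideal_dom_sim[OF I] by blast
  show "I = dom_in n (dom ` I)"
    unfolding dom_in_def using carrier monoid_ideal_dom_eq[OF I] by blast
qed

end
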